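(* Let $x,h>0$ be real numbers and let $k\ge 1$ be an integer. Then $$\det A_k(x,h)=h^{k(k+1)}\,(k^{!})^2\,g(h,k)\,f_k .$$ Here $f_k$ is the last term of the recursively defined sequence $f_0,\dots,f_k$ given in the context; in particular $f_k=f_{k-1}\left(\frac{h+1}{h}\right)^2-\frac{2h+1}{h^2}$. Moreover, $f_k=f(x,h,k)$.
   Context: For real $x,h>0$ and an integer $k\ge1$, $A_k(x,h)$ is the $(k+1)\times(k+1)$ matrix with $(1,1)$ entry equal to $x$ and $(i,j)$ entry equal to $\frac{1}{(i+j-2)h+1}$ for all $(i,j)\ne(1,1)$, $1\le i,j\le k+1$. Notation: $k^{!}:=\prod_{i=1}^{k} i!$ (product of factorials). For fixed $x,h,k$, define $f_0:=x$ and $$f_{\ell+1}:=f_\ell\left(\frac{(k-\ell)h+1}{(k-\ell)h}\right)^2-\frac{2(k-\ell)h+1}{((k-\ell)h)^2}\qquad(0\le \ell\le k-1).$$ Further, $$g(h,k):=\left(\frac{1}{kh+1}\right)^{k+1}\prod_{j=0}^{k-1}\left(\frac{1}{(jh+1)(2kh-jh+1)}\right)^{j+1},$$ $$f(x,h,k):=x\prod_{j=1}^{k}\left(\frac{jh+1}{jh}\right)^2-\sum_{m=1}^{k}\frac{2mh+1}{(mh)^2}\prod_{j=1}^{m-1}\left(\frac{jh+1}{jh}\right)^2,$$ where an empty product equals $1$. *)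

theory Defs
  imports Complex_Main "Jordan_Normal_Form.Determinant"
begin

(* Matrix indices start at 0 here, so the 1-based exponent i + j - 2 becomes i + j. *)
definition A_mat :: "nat \<Rightarrow> real \<Rightarrow> real \<Rightarrow> real mat" where
  "A_mat k x h = mat (k + 1) (k + 1)
     (\<lambda>(i, j). if i = 0 \<and> j = 0 then x else 1 / (real (i + j) * h + 1))"

definition prod_fact :: "nat \<Rightarrow> real" where
  "prod_fact k = (\<Prod>i = 1..k. fact i)"

(* Meaningful only up to index k: for l \<ge> k the truncated k - l is 0 and the step
   divides by 0. *)
primrec f_seq :: "real \<Rightarrow> real \<Rightarrow> nat \<Rightarrow> nat \<Rightarrow> real" where
  "f_seq x h k 0 = x"
| "f_seq x h k (Suc l) =
     f_seq x h k l * ((real (k - l) * h + 1) / (real (k - l) * h))\<^sup>2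
     - (2 * real (k - l) * h + 1) / (real (k - l) * h)\<^sup>2"

definition g_fun :: "real \<Rightarrow> nat \<Rightarrow> real" where
  "g_fun h k = (1 / (real k * h + 1)) ^ (k + 1) *
     (\<Prod>j<k. (1 / ((real j * h + 1) * (2 * real k * h - real j * h + 1))) ^ (j + 1))"

definition f_fun :: "real \<Rightarrow> real \<Rightarrow> nat \<Rightarrow> real" where
  "f_fun x h k =
     x * (\<Prod>j = 1..k. ((real j * h + 1) / (real j * h))\<^sup>2)
     - (\<Sum>m = 1..k. (2 * real m * h + 1) / (real m * h)\<^sup>2 *
          (\<Prod>j = 1..<m. ((real j * h + 1) / (real j * h))\<^sup>2))"

end

theory Submission
  imports Defs
begin

text \<open>
  Take the Schur complement of the last diagonal entry \<open>1 / (2kh + 1)\<close> of \<open>A_mat k x h\<close>. With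
  \<open>r i = (k - i) h / ((k + i) h + 1)\<close>, the Cauchy structure turns every entry
  \<open>1 / ((i + j) h + 1)\<close> into \<open>r i * r j / ((i + j) h + 1)\<close>, whereas the corner \<open>x\<close> becomes
  \<open>(r 0)\<^sup>2 * x'\<close>, where \<open>x'\<close> is the term \<open>f_1\<close> of the recursion started at \<open>x\<close>. Pulling out the
  factors \<open>r i\<close> from rows and columns leaves \<open>A_mat (k - 1) x' h\<close>, and \<open>f_k\<close> for \<open>(x, k)\<close> is
  \<open>f_(k - 1)\<close> for \<open>(x', k - 1)\<close>.
\<close>

text \<open>The matrix factors as \<open>L * B\<close>. The unit upper triangular \<open>L\<close>
  adds multiples of the last row to the others, and the last column of \<open>B\<close> vanishes
  above its bottom entry.\<close>

lemma det_schur_complement_last: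
  fixes a :: "nat \<Rightarrow> nat \<Rightarrow> 'a :: field"
  assumes "a n n \<noteq> 0"
  shows "det (mat (Suc n) (Suc n) (\<lambda>(i, j). a i j)) =
    a n n * det (mat n n (\<lambda>(i, j). a i j - a i n * a n j / a n n))"
proof -
  define L where "L = mat (Suc n) (Suc n)
    (\<lambda>(i, j). if i = j then 1 else if j = n then a i n / a n n else 0)"
  define B where "B = mat (Suc n) (Suc n)
    (\<lambda>(i, j). if i = n then a n j else a i j - a i n * a n j / a n n)"
  have carrier: "L \<in> carrier_mat (Suc n) (Suc n)" "B \<in> carrier_mat (Suc n) (Suc n)"
    by (simp_all add: L_def B_def)
  have "mat (Suc n) (Suc n) (\<lambda>(i, j). a i j) = L * B"
  proof (rule eq_matI)
    fix i j
    assume "i < dim_row (L * B)" "j < dim_col (L * B)"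
    then have ij: "i < Suc n" "j < Suc n"
      by (simp_all add: L_def B_def)
    have "(L * B) $$ (i, j) = (\<Sum>m<Suc n. L $$ (i, m) * B $$ (m, j))"
      using ij carrier by (simp add: scalar_prod_def atLeast0LessThan)
    also have "\<dots> = (\<Sum>m<n. (if i = m then B $$ (m, j) else 0)) + L $$ (i, n) * B $$ (n, j)"
      unfolding sum.lessThan_Suc using ij
      by (intro arg_cong2[of _ _ _ _ "(+)"] sum.cong refl) (auto simp: L_def)
    also have "\<dots> = a i j"
      using ij assms by (auto simp: L_def B_def less_Suc_eq)
    finally show "mat (Suc n) (Suc n) (\<lambda>(i, j). a i j) $$ (i, j) = (L * B) $$ (i, j)"
      using ij by simp
  qed (simp_all add: L_def B_def)
  moreover have "det L = 1"
  proof -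
    have "upper_triangular L"
      by (auto simp: L_def)
    then have "det L = prod_list (diag_mat L)"
      using carrier(1) by (rule det_upper_triangular)
    also have "\<dots> = 1"
      by (auto simp: prod_list_diag_prod L_def)
    finally show ?thesis .
  qed
  moreover have "det B = a n n * det (mat n n (\<lambda>(i, j). a i j - a i n * a n j / a n n))"
  proof -
    \<comment> \<open>For \<open>i < n\<close> the last-column entry is
      \<open>a i n - a i n * a n n / a n n = 0\<close>, so only the bottom term of the expansion
      survives.\<close>
    have "det B = (\<Sum>i<Suc n. B $$ (i, n) * cofactor B i n)"
      using carrier(2) by (intro laplace_expansion_column) auto
    also have "\<dots> = a n n * cofactor B n n"
      using assms by (simp add: B_def)
    also have "cofactor B n n = det (mat_delete B n n)"
      by (simp add: cofactor_def)
    also have "mat_delete B n n = mat n n (\<lambda>(i, j). a i j - a i n * a n j / a n n)"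
      by (rule eq_matI) (auto simp: mat_delete_def B_def)
    finally show ?thesis .
  qed
  ultimately show ?thesis
    using det_mult[OF carrier] by simp
qed

text \<open>Every term of the Leibniz formula takes one entry from each row and each column, so all
  terms share the same factor.\<close>

lemma det_scale_rows_cols:
  fixes a :: "nat \<Rightarrow> nat \<Rightarrow> 'a :: comm_ring_1"
  shows "det (mat n n (\<lambda>(i, j). r i * c j * a i j)) =
    (\<Prod>i<n. r i) * (\<Prod>j<n. c j) * det (mat n n (\<lambda>(i, j). a i j))"
proof -
  have "signof p * (\<Prod>i = 0..<n. r i * c (p i) * a i (p i)) =
      (\<Prod>i<n. r i) * (\<Prod>j<n. c j) * (signof p * (\<Prod>i = 0..<n. a i (p i)))"
    if "p permutes {0..<n}" for p
  proof -
    have "(\<Prod>i = 0..<n. c (p i)) = (\<Prod>j = 0..<n. c j)"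
      using prod.permute[OF that, of c] by (simp add: o_def)
    then show ?thesis
      by (simp add: prod.distrib atLeast0LessThan mult_ac)
  qed
  moreover have "(\<Prod>i = 0..<n. mat n n f $$ (i, p i)) = (\<Prod>i = 0..<n. f (i, p i))"
    if "p permutes {0..<n}" for p and f :: "nat \<times> nat \<Rightarrow> 'a"
    using permutes_in_image[OF that] by (intro prod.cong) auto
  ultimately show ?thesis
    by (simp add: det_def sum_distrib_left)
qed

definition corner_step :: "real \<Rightarrow> nat \<Rightarrow> real \<Rightarrow> real" where
  "corner_step h k x =
    x * ((real k * h + 1) / (real k * h))\<^sup>2 - (2 * real k * h + 1) / (real k * h)\<^sup>2"

text \<open>A step of the recursion sees its indices only through \<open>k - l\<close>. Hence the
  first step can be peeled off, as the induction on the matrix size requires, although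
  \<open>f_seq\<close> unfolds at its last step.\<close>

lemma f_seq_Suc_Suc:
  "f_seq x h (Suc k) (Suc l) = f_seq (corner_step h (Suc k) x) h k l"
  by (induction l) (simp_all add: corner_step_def)

text \<open>The product of the factors with index up to \<open>k\<close> is common to the
  \<open>x\<close> term and to the summand \<open>m = Suc k\<close>; collecting it leaves
  \<open>corner_step\<close> as its coefficient.\<close>

lemma f_fun_Suc: "f_fun x h (Suc k) = f_fun (corner_step h (Suc k) x) h k"
  by (simp add: f_fun_def corner_step_def atLeastLessThanSuc_atLeastAtMost
      left_diff_distrib right_diff_distrib mult_ac del: of_nat_Suc)

lemma f_seq_eq_f_fun: "f_seq x h k k = f_fun x h k"
proof (induction k arbitrary: x)
  case 0
  show ?case by (simp add: f_fun_def)
next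
  case (Suc k)
  then show ?case by (simp only: f_seq_Suc_Suc f_fun_Suc)
qed

lemma det_A_mat_Suc:
  fixes h :: real
  assumes "h > 0"
  shows "det (A_mat (Suc k) x h) =
    1 / (2 * real (Suc k) * h + 1) *
    (\<Prod>i<Suc k. real (Suc k - i) * h / (real (Suc k + i) * h + 1))\<^sup>2 *
    det (A_mat k (corner_step h (Suc k) x) h)"
proof -
  define n where "n = Suc k"
  \<comment> \<open>The corner \<open>y\<close> is a parameter, so that \<open>a\<close> describes
    both the original matrix and the reduced one.\<close>
  define a where
    "a = (\<lambda>y i j. if i = 0 \<and> j = 0 then y else 1 / (real (i + j) * h + 1))"
  define r where "r = (\<lambda>i. real (n - i) * h / (real (n + i) * h + 1))"
  have A: "A_mat m y h = mat (Suc m) (Suc m) (\<lambda>(i, j). a y i j)" for m y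
    by (simp add: A_mat_def a_def)
  have pos: "real m * h + 1 > 0" for m
    using assms by (simp add: add_nonneg_pos)
  have nn: "a x n n = 1 / (2 * real n * h + 1)"
    by (simp add: a_def n_def)
  have entry: "a x i j - a x i n * a x n j / a x n n = r i * r j * a (corner_step h n x) i j"
    if "i < n" "j < n" for i j
  proof (cases "i = 0 \<and> j = 0")
    \<comment> \<open>Both sides equal \<open>x - (2 * n * h + 1) / (n * h + 1)^2\<close>, because
      \<open>r 0 = n * h / (n * h + 1)\<close>.\<close>
    case True
    have "real n * h > 0"
      using assms by (simp add: n_def)
    then show ?thesis
      using True assms pos[of n] pos[of "2 * n"] that
      by (simp add: a_def r_def corner_step_def divide_simps) (simp add: power2_eq_square algebra_simps)
  next
    case False
    define p where "p = (\<lambda>m. real m * h + 1)"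
    have p_pos: "p m > 0" for m
      using pos by (simp add: p_def)
    have "real (n - i) * h / p (n + i) * (real (n - j) * h / p (n + j)) * (1 / p (i + j)) =
        (real (n - i) * h) * (real (n - j) * h) / (p (n + i) * p (n + j) * p (i + j))"
      by simp
    \<comment> \<open>Since (n + i) + (n + j) = (i + j) + (n + n), the terms constant and linear in
      \<open>h\<close> cancel; the coefficient of h^2 is (n + i)(n + j) - 2n(i + j) = (n - i)(n -
      j).\<close>
    also have "(real (n - i) * h) * (real (n - j) * h) =
        p (n + i) * p (n + j) - p (i + j) * p (n + n)"
      using that by (simp add: p_def algebra_simps of_nat_diff)
    also have "\<dots> / (p (n + i) * p (n + j) * p (i + j)) =
        1 / p (i + j) - 1 / p (n + i) * (1 / p (n + j)) / (1 / p (n + n))"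
      using p_pos[of "i + j"] p_pos[of "n + i"] p_pos[of "n + j"]
      by (simp add: diff_divide_distrib)
    finally have "1 / p (i + j) - 1 / p (n + i) * (1 / p (n + j)) / (1 / p (n + n)) =
        real (n - i) * h / p (n + i) * (real (n - j) * h / p (n + j)) * (1 / p (i + j))" ..
    moreover have "a y i j = 1 / p (i + j)" "a y i n = 1 / p (n + i)"
      "a y n j = 1 / p (n + j)" "a y n n = 1 / p (n + n)" for y
      using False that by (auto simp: a_def p_def add.commute)
    moreover have "r m = real (n - m) * h / p (n + m)" for m
      by (simp add: r_def p_def)
    ultimately show ?thesis
      by simp
  qed
  have "a x n n \<noteq> 0"
    using pos[of "2 * n"] by (simp add: nn)
  then have "det (A_mat n x h) =
      a x n n * det (mat n n (\<lambda>(i, j). a x i j - a x i n * a x n j / a x n n))"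
    by (simp add: A det_schur_complement_last)
  also have "mat n n (\<lambda>(i, j). a x i j - a x i n * a x n j / a x n n) =
      mat n n (\<lambda>(i, j). r i * r j * a (corner_step h n x) i j)"
    using entry by (intro cong_mat) auto
  also have "det \<dots> = (\<Prod>i<n. r i)\<^sup>2 * det (A_mat k (corner_step h n x) h)"
    by (simp add: det_scale_rows_cols A n_def power2_eq_square)
  finally show ?thesis
    unfolding nn by (simp only: r_def n_def mult.assoc)
qed

text \<open>Each linear factor gets its natural index here, so that passing from \<open>k\<close> to \<open>k + 1\<close>
  is a shift of the product index.\<close>

lemma g_fun_factors:
  fixes h :: real
  defines "u \<equiv> \<lambda>m. real m * h + 1"
  shows "g_fun h k = 1 / ((\<Prod>j<Suc k. u j ^ (j + 1)) * (\<Prod>j<k. u (2 * k - j) ^ (j + 1)))"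
proof -
  have "(\<Prod>j<k. (1 / ((real j * h + 1) * (2 * real k * h - real j * h + 1))) ^ (j + 1)) =
      (\<Prod>j<k. 1 / (u j ^ (j + 1) * u (2 * k - j) ^ (j + 1)))"
    by (intro prod.cong refl)
      (simp add: u_def of_nat_diff power_divide power_mult_distrib left_diff_distrib)
  then show ?thesis
    by (simp add: g_fun_def u_def prod_dividef prod.distrib power_divide)
qed

lemma g_fun_Suc:
  fixes h :: real
  assumes "h > 0"
  shows "g_fun h (Suc k) = g_fun h k /
    ((2 * real (Suc k) * h + 1) * (\<Prod>i<Suc k. real (Suc k + i) * h + 1)\<^sup>2)"
proof -
  define u where "u = (\<lambda>m. real m * h + 1)"
  define W where "W = (\<Prod>j<k. u (2 * k - j))"
  \<comment> \<open>The new factor \<open>u (Suc k) ^ (k + 2)\<close> of the lower product is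
    exactly the missing term \<open>j = Suc k\<close> of the upper one, as 2(k + 1) - (k + 1) = k +
    1.\<close>
  have "(\<Prod>j<Suc k. u (2 * Suc k - j) ^ (j + 1)) * u (Suc k) ^ (k + 2) =
      (\<Prod>j<Suc (Suc k). u (2 * Suc k - j) ^ (j + 1))"
    by simp
  \<comment> \<open>Splitting off \<open>j = 0\<close> and \<open>j = 1\<close> and shifting by two
    restores the bases \<open>u (2 * k - j)\<close>, with exponents raised by two; this is where the
    square of \<open>W\<close> comes from.\<close>
  also have "\<dots> = u (2 * k + 2) * u (2 * k + 1) ^ 2 * (\<Prod>j<k. u (2 * k - j) ^ (j + 3))"
    unfolding prod.lessThan_Suc_shift by (simp add: eval_nat_numeral mult_ac)
  also have "(\<Prod>j<k. u (2 * k - j) ^ (j + 3)) = (\<Prod>j<k. u (2 * k - j) ^ (j + 1)) * W\<^sup>2"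
    by (simp add: W_def prod_power_distrib flip: prod.distrib)
      (simp add: eval_nat_numeral mult_ac)
  finally have upper: "(\<Prod>j<Suc k. u (2 * Suc k - j) ^ (j + 1)) * u (Suc k) ^ (k + 2) =
      u (2 * k + 2) * u (2 * k + 1) ^ 2 * ((\<Prod>j<k. u (2 * k - j) ^ (j + 1)) * W\<^sup>2)" .
  have "(\<Prod>i<Suc k. u (Suc k + i)) = (\<Prod>i<Suc k. u (Suc k + (Suc k - Suc i)))"
    by (rule prod.nat_diff_reindex[symmetric])
  also have "\<dots> = (\<Prod>i<Suc k. u (2 * k + 1 - i))"
    by (intro prod.cong refl arg_cong[of _ _ u]) auto
  also have "\<dots> = u (2 * k + 1) * W"
    unfolding prod.lessThan_Suc_shift W_def by simp
  finally have mid: "(\<Prod>i<Suc k. u (Suc k + i)) = u (2 * k + 1) * W" .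
  have "(\<Prod>j<Suc (Suc k). u j ^ (j + 1)) * (\<Prod>j<Suc k. u (2 * Suc k - j) ^ (j + 1)) =
      (\<Prod>j<Suc k. u j ^ (j + 1)) *
      ((\<Prod>j<Suc k. u (2 * Suc k - j) ^ (j + 1)) * u (Suc k) ^ (k + 2))"
    by (simp add: mult_ac)
  also have "\<dots> = (\<Prod>j<Suc k. u j ^ (j + 1)) * (\<Prod>j<k. u (2 * k - j) ^ (j + 1)) *
      (u (2 * k + 2) * (\<Prod>i<Suc k. u (Suc k + i))\<^sup>2)"
    unfolding upper mid by (simp only: power_mult_distrib mult_ac)
  finally have "g_fun h (Suc k) =
      g_fun h k / (u (2 * k + 2) * (\<Prod>i<Suc k. u (Suc k + i))\<^sup>2)"
    unfolding g_fun_factors u_def by (simp only: divide_divide_eq_left)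
  moreover have "u (2 * k + 2) = 2 * real (Suc k) * h + 1"
    by (simp add: u_def)
  ultimately show ?thesis
    by (simp only: u_def)
qed

lemma prod_rev_scaled:
  fixes h :: real
  shows "(\<Prod>i<n. real (n - i) * h) = h ^ n * fact n"
proof -
  have "(\<Prod>i<n. real (n - i)) = (\<Prod>i<n. real (Suc i))"
    using prod.nat_diff_reindex[of "\<lambda>i. real (Suc i)" n]
    by (simp add: Suc_diff_Suc cong: prod.cong_simp)
  then show ?thesis
    by (simp add: prod.distrib fact_prod_Suc atLeast0LessThan)
qed

lemma det_A_mat:
  fixes h :: real
  assumes "h > 0"
  shows "det (A_mat k x h) =
    h ^ (k * (k + 1)) * (prod_fact k)\<^sup>2 * g_fun h k * f_seq x h k k"
\<comment> \<open>The corner changes with each reduction, hence the generalization over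
  \<open>x\<close>.\<close>
proof (induction k arbitrary: x)
  case 0
  have "det (A_mat 0 x h) = x"
    by (subst det_single) (simp_all add: A_mat_def)
  then show ?case
    by (simp add: prod_fact_def g_fun_def)
next
  case (Suc k)
  let ?P = "\<Prod>i<Suc k. real (Suc k + i) * h + 1"
  have "det (A_mat (Suc k) x h) =
      1 / (2 * real (Suc k) * h + 1) * (h ^ Suc k * fact (Suc k) / ?P)\<^sup>2 *
      (h ^ (k * (k + 1)) * (prod_fact k)\<^sup>2 * g_fun h k * f_seq x h (Suc k) (Suc k))"
    unfolding det_A_mat_Suc[OF assms] Suc.IH f_seq_Suc_Suc prod_dividef prod_rev_scaled ..
  also have "\<dots> = (h ^ (k * (k + 1)) * (h ^ Suc k)\<^sup>2) * (prod_fact k * fact (Suc k))\<^sup>2 *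
      (g_fun h k / ((2 * real (Suc k) * h + 1) * ?P\<^sup>2)) * f_seq x h (Suc k) (Suc k)"
    by (simp only: power_divide power_mult_distrib times_divide_eq_left times_divide_eq_right
        divide_divide_eq_left mult_1 mult_ac)
  \<comment> \<open>The exponents add up as k(k + 1) + 2(k + 1) = (k + 1)(k + 2).\<close>
  also have "h ^ (k * (k + 1)) * (h ^ Suc k)\<^sup>2 = h ^ (Suc k * (Suc k + 1))"
    by (simp only: flip: power_add power_mult) (rule arg_cong[of _ _ "power h"], simp)
  also have "prod_fact k * fact (Suc k) = prod_fact (Suc k)"
    unfolding prod_fact_def by simp
  also have "g_fun h k / ((2 * real (Suc k) * h + 1) * ?P\<^sup>2) = g_fun h (Suc k)"
    by (rule g_fun_Suc[OF assms, symmetric])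
  finally show ?case .
qed

theorem theorem3p1:
  fixes x h :: real and k :: nat
  assumes "x > 0" and "h > 0" and "k \<ge> 1"
  shows "det (A_mat k x h) = h ^ (k * (k + 1)) * (prod_fact k)\<^sup>2 * g_fun h k * f_seq x h k k
    \<and> f_seq x h k k = f_seq x h k (k - 1) * ((h + 1) / h)\<^sup>2 - (2 * h + 1) / h\<^sup>2
    \<and> f_seq x h k k = f_fun x h k"
proof -
  \<comment> \<open>With \<open>k = Suc m\<close> the last step of the recursion has
    \<open>k - l = 1\<close>, which gives the coefficients in \<open>h\<close> alone.\<close>
  obtain m where "k = Suc m"
    using assms(3) by (cases k) auto
  then have "f_seq x h k k = f_seq x h k (k - 1) * ((h + 1) / h)\<^sup>2 - (2 * h + 1) / h\<^sup>2"
    by simp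
  then show ?thesis
    using det_A_mat[OF assms(2)] f_seq_eq_f_fun by blast
qed

end
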